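(* Let $X$ be a compact Riemannian manifold and let $d\ge1$ be an integer. There exists a $C^0$-Baire residual subset $\mathfrak R\subset\mathrm{Homeo}(X)$ such that the following holds: for every $f\in\mathfrak R$ there exists a $C^0$-Baire residual subset $\mathfrak R_f\subset C^0(X,\mathbb R^d)$ such that for any $\varphi\in\mathfrak R_f$ there exist $\mu_1,\mu_2\in\mathcal M_{inv}(f)$ with $\int\varphi\,d\mu_1\ne\int\varphi\,d\mu_2$.
   Context: $\mathrm{Homeo}(X)$ is the space of homeomorphisms of $X$ with the topology of $d_{C^0}(f,g)=\max\{\sup_x \mathrm{dist}(f(x),g(x)),\sup_x \mathrm{dist}(f^{-1}(x),g^{-1}(x))\}$, and $C^0(X,\mathbb R^d)$ has the uniform topology. $\mathcal M_{inv}(f)$ is the space of $f$-invariant Borel probability measures. A subset of a topological space is Baire residual if it contains a countable intersection of open and dense subsets. *)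

theory Defs
  imports "HOL-Probability.Probability"
begin

section \<open>Riemannian manifolds\<close>

text \<open>
  For open \<open>S\<close> in a Euclidean space, \<open>f\<close> is of class \<open>C\<close>-\<open>(k+1)\<close> on \<open>S\<close> iff it is differentiable on \<open>S\<close>
  and all its directional derivatives \<open>\<lambda>x. f' x v\<close> are of class \<open>C\<close>-\<open>k\<close> on \<open>S\<close>.
\<close>

primrec Ck_on :: "nat \<Rightarrow> ('v::euclidean_space \<Rightarrow> 'b::real_normed_vector) \<Rightarrow> 'v set \<Rightarrow> bool" where
  "Ck_on 0 f S \<longleftrightarrow> continuous_on S f"
| "Ck_on (Suc k) f S \<longleftrightarrow>
     (\<exists>f'. (\<forall>x\<in>S. (f has_derivative f' x) (at x)) \<and> (\<forall>v. Ck_on k (\<lambda>x. f' x v) S))"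

definition smooth_on :: "('v::euclidean_space \<Rightarrow> 'b::real_normed_vector) \<Rightarrow> 'v set \<Rightarrow> bool" where
  "smooth_on f S \<longleftrightarrow> open S \<and> (\<forall>k. Ck_on k f S)"

text \<open>
  A chart is a pair \<open>(U, \<phi>)\<close> of a domain and a coordinate map; \<open>\<phi>\<close> is only relevant on \<open>U\<close>.
  Coordinates are indexed by the (nonempty, finite) type \<open>'n\<close>, so manifolds have pure
  dimension \<open>CARD('n) \<ge> 1\<close>.
\<close>

type_synonym ('a, 'n) chart = "'a set \<times> ('a \<Rightarrow> real ^ 'n)"

definition transition :: "('a, 'n::finite) chart \<Rightarrow> ('a, 'n) chart \<Rightarrow> real ^ 'n \<Rightarrow> real ^ 'n" where
  "transition c c' = snd c' \<circ> inv_into (fst c) (snd c)"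

definition smooth_atlas :: "('a::topological_space, 'n::finite) chart set \<Rightarrow> bool" where
  "smooth_atlas A \<longleftrightarrow>
     (\<Union>(U, \<phi>)\<in>A. U) = UNIV \<and>
     (\<forall>(U, \<phi>)\<in>A. open U \<and> open (\<phi> ` U) \<and> homeomorphism U (\<phi> ` U) \<phi> (inv_into U \<phi>)) \<and>
     (\<forall>(U, \<phi>)\<in>A. \<forall>(V, \<psi>)\<in>A. smooth_on (transition (U, \<phi>) (V, \<psi>)) (\<phi> ` (U \<inter> V)))"

text \<open>
  A Riemannian metric is given by its matrix \<open>G c y\<close> in each chart \<open>c\<close>, at the point with
  coordinates \<open>y\<close>. The last condition is the transformation rule of a symmetric 2-tensor.
\<close>

definition riemannian_metric ::
  "('a::topological_space, 'n::finite) chart set \<Rightarrow>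
   (('a, 'n) chart \<Rightarrow> real ^ 'n \<Rightarrow> real ^ 'n ^ 'n) \<Rightarrow> bool" where
  "riemannian_metric A G \<longleftrightarrow>
     (\<forall>c\<in>A. smooth_on (G c) (snd c ` fst c)) \<and>
     (\<forall>c\<in>A. \<forall>y\<in>snd c ` fst c.
        transpose (G c y) = G c y \<and> (\<forall>v. v \<noteq> 0 \<longrightarrow> v \<bullet> (G c y *v v) > 0)) \<and>
     (\<forall>c\<in>A. \<forall>c'\<in>A. \<forall>y\<in>snd c ` (fst c \<inter> fst c').
        let \<tau> = transition c c'; D = frechet_derivative \<tau> (at y)
        in \<forall>v w. v \<bullet> (G c y *v w) = D v \<bullet> (G c' (\<tau> y) *v D w))"

definition piecewise_C1_curve ::
  "('a::topological_space, 'n::finite) chart set \<Rightarrow> (real \<Rightarrow> 'a) \<Rightarrow> bool" where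
  "piecewise_C1_curve A \<gamma> \<longleftrightarrow>
     path \<gamma> \<and>
     (\<forall>(U, \<phi>)\<in>A. \<forall>a b. {a..b} \<subseteq> {0..1} \<and> \<gamma> ` {a..b} \<subseteq> U
        \<longrightarrow> (\<phi> \<circ> \<gamma>) piecewise_C1_differentiable_on {a..b})"

text \<open>By the transformation rule the speed does not depend on the chart that \<open>SOME\<close> selects.\<close>

definition speed ::
  "('a, 'n::finite) chart set \<Rightarrow> (('a, 'n) chart \<Rightarrow> real ^ 'n \<Rightarrow> real ^ 'n ^ 'n) \<Rightarrow>
   (real \<Rightarrow> 'a) \<Rightarrow> real \<Rightarrow> real" where
  "speed A G \<gamma> t =
     (let c = (SOME c. c \<in> A \<and> \<gamma> t \<in> fst c);
          v = vector_derivative (snd c \<circ> \<gamma>) (at t)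
      in sqrt (v \<bullet> (G c (snd c (\<gamma> t)) *v v)))"

text \<open>
  The length is a nonnegative Lebesgue integral: the derivative of a curve that is piecewise
  \<open>C1\<close> in the library's sense may be unbounded near its finitely many exceptional points, and
  a curve of non-integrable speed must have length \<open>\<infinity>\<close>, not \<open>0\<close>.
\<close>

definition curve_length ::
  "('a, 'n::finite) chart set \<Rightarrow> (('a, 'n) chart \<Rightarrow> real ^ 'n \<Rightarrow> real ^ 'n ^ 'n) \<Rightarrow>
   (real \<Rightarrow> 'a) \<Rightarrow> ennreal" where
  "curve_length A G \<gamma> = (\<integral>\<^sup>+t\<in>{0..1}. ennreal (speed A G \<gamma> t) \<partial>lborel)"

definition riemannian_distance ::
  "('a::topological_space, 'n::finite) chart set \<Rightarrow>
   (('a, 'n) chart \<Rightarrow> real ^ 'n \<Rightarrow> real ^ 'n ^ 'n) \<Rightarrow> 'a \<Rightarrow> 'a \<Rightarrow> ennreal" where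
  "riemannian_distance A G x y =
     (INF \<gamma>\<in>{\<gamma>. piecewise_C1_curve A \<gamma> \<and> pathstart \<gamma> = x \<and> pathfinish \<gamma> = y}. curve_length A G \<gamma>)"

text \<open>
  The manifold is the whole type, and the type-class distance is required to be the
  Riemannian one, which always induces the manifold topology. The Riemannian distance between
  points of different components is \<open>\<infinity>\<close>; there \<open>dist\<close> may be any real-valued extension
  that is still a metric for the manifold topology.
\<close>

locale riemannian_manifold =
  fixes A :: "('a::metric_space, 'n::finite) chart set"
    and G :: "('a, 'n) chart \<Rightarrow> real ^ 'n \<Rightarrow> real ^ 'n ^ 'n"
  assumes smooth_atlas: "smooth_atlas A"
    and riemannian_metric: "riemannian_metric A G"
    and dist_eq_riemannian_distance:
      "connected_component UNIV x y \<Longrightarrow> ennreal (dist x y) = riemannian_distance A G x y"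


section \<open>Homeomorphisms, residual sets and invariant measures\<close>

definition Homeo :: "('a::topological_space \<Rightarrow> 'a) set" where
  "Homeo = {f. homeomorphism UNIV UNIV f (inv f)}"

definition dist_C0 :: "('a::metric_space \<Rightarrow> 'a) \<Rightarrow> ('a \<Rightarrow> 'a) \<Rightarrow> real" where
  "dist_C0 f g = max (SUP x. dist (f x) (g x)) (SUP x. dist (inv f x) (inv g x))"

lemma Metric_space_Homeo:
  assumes "compact (UNIV :: 'a::metric_space set)"
  shows "Metric_space (Homeo :: ('a \<Rightarrow> 'a) set) dist_C0"
proof
  have bdd: "bdd_above (range (\<lambda>x. dist (f x) (g x)))" for f g :: "'a \<Rightarrow> 'a"
    using compact_imp_bounded[OF assms]
    by (intro bounded_imp_bdd_above bounded_dist_comp) (auto intro: bounded_subset)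
  have up: "dist (f x) (g x) \<le> (SUP x. dist (f x) (g x))" for f g :: "'a \<Rightarrow> 'a" and x
    by (rule cSUP_upper[OF _ bdd]) simp
  fix f g h :: "'a \<Rightarrow> 'a"
  show "0 \<le> dist_C0 f g"
    unfolding dist_C0_def using order_trans[OF zero_le_dist up[where f=f and g=g and x=undefined]] by linarith
  show "dist_C0 f g = dist_C0 g f"
    unfolding dist_C0_def by (simp add: dist_commute)
  show "dist_C0 f g = 0 \<longleftrightarrow> f = g"
  proof
    assume "dist_C0 f g = 0"
    then have "dist (f x) (g x) \<le> 0" for x
      unfolding dist_C0_def using up[where f=f and g=g and x=x] by linarith
    then show "f = g" by auto
  qed (simp add: dist_C0_def)
  have tri: "(SUP x. dist (f x) (h x)) \<le> (SUP x. dist (f x) (g x)) + (SUP x. dist (g x) (h x))"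
    for f g h :: "'a \<Rightarrow> 'a"
    by (rule cSUP_least)
       (auto intro: order_trans[OF dist_triangle] add_mono[OF up up])
  show "dist_C0 f h \<le> dist_C0 f g + dist_C0 g h"
    unfolding dist_C0_def using tri[where f=f and g=g and h=h]
      tri[where f="inv f" and g="inv g" and h="inv h"] by linarith
qed

definition Homeo_topology :: "('a::metric_space \<Rightarrow> 'a) topology" where
  "Homeo_topology = Metric_space.mtopology Homeo dist_C0"

definition baire_residual :: "'b topology \<Rightarrow> 'b set \<Rightarrow> bool" where
  "baire_residual T R \<longleftrightarrow>
     R \<subseteq> topspace T \<and>
     (\<exists>U :: nat \<Rightarrow> 'b set.
        (\<forall>n. openin T (U n) \<and> T closure_of (U n) = topspace T) \<and> (\<Inter>n. U n) \<subseteq> R)"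

definition invariant_measures :: "('a::topological_space \<Rightarrow> 'a) \<Rightarrow> 'a measure set" where
  "invariant_measures f = {\<mu>. prob_space \<mu> \<and> sets \<mu> = sets borel \<and> distr \<mu> borel f = \<mu>}"

end

theory Submission
  imports Defs
begin

text \<open>
  A generic homeomorphism has at least two periodic orbits, hence at least two invariant
  measures, and a generic observable tells these two measures apart.

  The generic set of homeomorphisms is the interior of the set of those that have two disjoint
  finite invariant sets; only its density needs an argument. Let \<open>f\<close> be any homeomorphism. By
  compactness some orbit returns to a small coordinate ball (lemma \<open>returning_orbit\<close>). Composing
  \<open>f\<close> with a strong contraction supported in that ball turns the returning orbit segment into an
  attracting cycle of discs (lemma \<open>exists_robust_attractor_nearby\<close>). To be such a cycle means that
  finitely many compact sets are mapped into open sets, which is an open condition, and Brouwer's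
  fixed point theorem supplies a periodic point in every such cycle. So the periodic orbit survives
  all small perturbations, although its position may change.

  For the second orbit, note that the complement of an attracting region is invariant under the
  inverse map. The same construction applied to the inverse, in this complement, yields a repelling
  cycle of discs, disjoint from the first cycle; if the perturbation is small enough, the first
  cycle persists (lemma \<open>robust_two_periodic_orbits_nearby\<close>).

  The uniform distributions on two disjoint finite invariant sets \<open>S\<close> and \<open>T\<close> are invariant measures.
  The observables whose averages over \<open>S\<close> and \<open>T\<close> agree form a proper closed subspace, whose
  complement is open and dense (lemma \<open>averages_differ_open_dense\<close>).
\<close>

section \<open>Invariant measures on finite invariant sets\<close>

definition uniform_measure_on :: "'a::topological_space set \<Rightarrow> 'a measure" where
  "uniform_measure_on S = distr (measure_pmf (pmf_of_set S)) borel (\<lambda>x. x)"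

lemma uniform_measure_on_invariant:
  fixes f :: "'a::topological_space \<Rightarrow> 'a"
  assumes "finite S" "S \<noteq> {}" "f ` S = S" "continuous_on UNIV f"
  shows "uniform_measure_on S \<in> invariant_measures f"
proof -
  have f: "f \<in> borel_measurable borel"
    using assms(4) by (rule borel_measurable_continuous_onI)
  have inj: "inj_on f S"
    using assms(1,3) by (simp add: eq_card_imp_inj_on)
  have "distr (uniform_measure_on S) borel f = distr (measure_pmf (pmf_of_set S)) borel f"
    unfolding uniform_measure_on_def using f by (subst distr_distr) (auto simp: comp_def)
  also have "\<dots> = distr (measure_pmf (map_pmf f (pmf_of_set S))) borel (\<lambda>x. x)"
    by (simp add: map_pmf_rep_eq distr_distr comp_def)
  also have "map_pmf f (pmf_of_set S) = pmf_of_set S"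
    using inj assms(1-3) by (simp add: map_pmf_of_set_inj)
  finally have "distr (uniform_measure_on S) borel f = uniform_measure_on S"
    by (simp add: uniform_measure_on_def)
  moreover have "prob_space (uniform_measure_on S)"
    unfolding uniform_measure_on_def by (rule measure_pmf.prob_space_distr) simp
  ultimately show ?thesis
    by (simp add: invariant_measures_def uniform_measure_on_def)
qed

lemma integral_uniform_measure_on:
  fixes g :: "'a::topological_space \<Rightarrow> 'b::euclidean_space"
  assumes "finite S" "S \<noteq> {}" "continuous_on UNIV g"
  shows "(\<integral>x. g x \<partial>uniform_measure_on S) = (1 / real (card S)) *\<^sub>R (\<Sum>x\<in>S. g x)"
proof -
  have "(\<integral>x. g x \<partial>uniform_measure_on S) = (\<integral>x. g x \<partial>measure_pmf (pmf_of_set S))"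
    unfolding uniform_measure_on_def
    using borel_measurable_continuous_onI[OF assms(3)] by (subst integral_distr) auto
  also have "\<dots> = (\<Sum>x\<in>S. pmf (pmf_of_set S) x *\<^sub>R g x)"
    using assms by (intro integral_measure_pmf) auto
  also have "\<dots> = (1 / real (card S)) *\<^sub>R (\<Sum>x\<in>S. g x)"
    using assms by (simp add: scaleR_sum_right)
  finally show ?thesis .
qed

text \<open>
  The difference of the two averages is a bounded linear map \<open>L\<close> of the observable, so the set in
  question is the complement of a closed subspace. The distance to \<open>S\<close> shows that \<open>L\<close> is not
  zero, and adding a small multiple of a function outside the kernel leaves the kernel; this gives
  density.
\<close>

lemma averages_differ_open_dense:
  fixes S T :: "'a::metric_space set"
  assumes S: "finite S" "S \<noteq> {}" and T: "finite T" "T \<noteq> {}" and disj: "S \<inter> T = {}"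
  defines "D \<equiv> {\<phi> :: 'a \<Rightarrow>\<^sub>C (real ^ 'd::finite).
     (1 / real (card S)) *\<^sub>R (\<Sum>x\<in>S. apply_bcontfun \<phi> x) \<noteq> (1 / real (card T)) *\<^sub>R (\<Sum>x\<in>T. apply_bcontfun \<phi> x)}"
  shows "open D" "closure D = UNIV"
proof -
  define L where "L \<phi> = (1 / real (card S)) *\<^sub>R (\<Sum>x\<in>S. apply_bcontfun \<phi> x) - (1 / real (card T)) *\<^sub>R (\<Sum>x\<in>T. apply_bcontfun \<phi> x)"
    for \<phi> :: "'a \<Rightarrow>\<^sub>C (real ^ 'd::finite)"
  have D: "D = {\<phi>. L \<phi> \<noteq> 0}"
    by (auto simp: D_def L_def)
  have ev: "bounded_linear (\<lambda>\<phi> :: 'a \<Rightarrow>\<^sub>C (real ^ 'd::finite). apply_bcontfun \<phi> x)" for x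
    by (rule bounded_linear_intro[where K=1])
      (use norm_bounded in auto)
  have L: "bounded_linear L"
    unfolding L_def[abs_def]
    by (intro bounded_linear_sub bounded_linear_scaleR_right[THEN bounded_linear_compose]
        bounded_linear_sum ev)
  interpret L: bounded_linear L by (rule L)
  have "closed (L -` {0})"
    using L.continuous_on[OF continuous_on_id] by (intro closed_vimage) auto
  moreover have "D = - (L -` {0})"
    by (auto simp: D)
  ultimately show "open D"
    by (simp add: open_Compl)
  \<comment> \<open>a function vanishing on \<open>S\<close> and positive on \<open>T\<close>, truncated to be bounded\<close>
  define u :: "'a \<Rightarrow> real ^ 'd" where "u x = (min 1 (infdist x S)) *\<^sub>R 1" for x
  have "u \<in> bcontfun"
  proof (rule bcontfun_normI)
    show "continuous_on UNIV u"
      unfolding u_def by (intro continuous_intros)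
    show "norm (u x) \<le> norm (1 :: real ^ 'd)" for x
      using infdist_nonneg[of x S] by (auto simp: u_def mult_left_le_one_le)
  qed
  then obtain \<phi>0 where \<phi>0: "apply_bcontfun \<phi>0 = u"
    by (metis bcontfunE)
  have "L \<phi>0 \<noteq> 0"
  proof -
    have "(\<Sum>x\<in>S. u x) = 0"
      by (auto simp: u_def intro!: sum.neutral)
    moreover have "infdist x S > 0" if "x \<in> T" for x
      using that S disj finite_imp_closed infdist_pos_not_in_closed by blast
    then have "(\<Sum>x\<in>T. min 1 (infdist x S)) > 0"
      using T by (intro sum_pos) auto
    then have "(\<Sum>x\<in>T. u x) \<noteq> 0"
      unfolding u_def scaleR_sum_left[symmetric] by (simp add: vec_eq_iff)
    ultimately show ?thesis
      using T by (simp add: L_def \<phi>0)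
  qed
  have "\<phi> \<in> closure D" for \<phi>
  proof (cases "L \<phi> = 0")
    case True
    show ?thesis
      unfolding closure_approachable
    proof (intro allI impI)
      fix e :: real assume e: "e > 0"
      define c where "c = norm \<phi>0 + 1"
      have c: "c > 0" "norm \<phi>0 < c" by (auto simp: c_def add_nonneg_pos)
      define t where "t = e / c"
      have t: "t > 0" using e c by (simp add: t_def)
      have "L (\<phi> + t *\<^sub>R \<phi>0) \<noteq> 0"
        using True \<open>L \<phi>0 \<noteq> 0\<close> t by (simp add: L.add L.scaleR)
      moreover have "dist (\<phi> + t *\<^sub>R \<phi>0) \<phi> < e"
      proof -
        have "t * norm \<phi>0 < t * c"
          using t c by (intro mult_strict_left_mono)
        also have "\<dots> = e"
          using c by (simp add: t_def)
        finally show ?thesis using t by (simp add: dist_norm)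
      qed
      ultimately show "\<exists>y\<in>D. dist y \<phi> < e"
        unfolding D by blast
    qed
  next
    case False
    then show ?thesis
      using closure_subset[of D] by (auto simp: D)
  qed
  then show "closure D = UNIV" by blast
qed

section \<open>Topology of the homeomorphism space\<close>

lemma HomeoD:
  assumes "f \<in> Homeo"
  shows "continuous_on UNIV f" "continuous_on UNIV (inv f)" "bij f"
  using assms by (auto simp: Homeo_def homeomorphism_def bij_def inj_on_def surj_def) metis+

lemma Homeo_compactI:
  fixes f :: "'a::metric_space \<Rightarrow> 'a"
  assumes "compact (UNIV :: 'a set)" "continuous_on UNIV f" "bij f"
  shows "f \<in> Homeo"
proof -
  obtain g where g: "homeomorphism UNIV UNIV f g"
    using homeomorphism_compact[of UNIV f UNIV] assms by (auto simp: bij_def)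
  then have "inv f = g"
    by (intro inv_equality) (auto simp: homeomorphism_def)
  with g show ?thesis by (simp add: Homeo_def)
qed

lemma dist_le_dist_C0:
  fixes f g :: "'a::metric_space \<Rightarrow> 'a"
  assumes "compact (UNIV :: 'a set)"
  shows "dist (f x) (g x) \<le> dist_C0 f g"
proof -
  have "bdd_above (range (\<lambda>x. dist (f x) (g x)))"
    using compact_imp_bounded[OF assms]
    by (intro bounded_imp_bdd_above bounded_dist_comp) (auto intro: bounded_subset)
  then have "dist (f x) (g x) \<le> (SUP x. dist (f x) (g x))"
    by (intro cSUP_upper) auto
  then show ?thesis by (simp add: dist_C0_def)
qed

lemma dist_C0_le:
  assumes "\<And>x. dist (f x) (g x) \<le> e" "\<And>x. dist (inv f x) (inv g x) \<le> e"
  shows "dist_C0 f g \<le> e"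
  unfolding dist_C0_def using assms by (auto intro!: cSUP_least)

lemma inv_in_Homeo: "f \<in> Homeo \<Longrightarrow> inv f \<in> Homeo"
  using HomeoD[of f] inv_inv_eq[of f]
  by (auto simp: Homeo_def homeomorphism_symD)

lemma dist_C0_inv:
  assumes "f \<in> Homeo" "g \<in> Homeo"
  shows "dist_C0 (inv f) (inv g) = dist_C0 f g"
  using assms by (simp add: dist_C0_def HomeoD inv_inv_eq max.commute)

context
  assumes cpt: "compact (UNIV :: 'a::metric_space set)"
begin

interpretation H: Metric_space "Homeo :: ('a \<Rightarrow> 'a) set" dist_C0
  by (rule Metric_space_Homeo[OF cpt])

lemma topspace_Homeo_topology: "topspace (Homeo_topology :: ('a \<Rightarrow> 'a) topology) = Homeo"
  by (simp add: Homeo_topology_def)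

lemma openin_Homeo_topology_iff:
  "openin (Homeo_topology :: ('a \<Rightarrow> 'a) topology) N \<longleftrightarrow>
     N \<subseteq> Homeo \<and> (\<forall>f\<in>N. \<exists>e>0. \<forall>g\<in>Homeo. dist_C0 f g < e \<longrightarrow> g \<in> N)"
  unfolding Homeo_topology_def H.openin_mtopology by (fastforce simp: subset_iff)

text \<open>
  The compact image \<open>f ` K\<close> keeps a positive distance from the complement of \<open>V\<close>. The trapping
  conditions of this kind are what makes the constructions below survive perturbation.
\<close>

lemma openin_maps_into_open:
  assumes K: "closed K" and O: "open V"
  shows "openin (Homeo_topology :: ('a \<Rightarrow> 'a) topology) {g \<in> Homeo. g ` K \<subseteq> V}"
  unfolding openin_Homeo_topology_iff
proof (intro conjI ballI; clarsimp)
  fix f :: "'a \<Rightarrow> 'a" assume f: "f \<in> Homeo" "f ` K \<subseteq> V"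
  have "compact (f ` K)"
    using K cpt HomeoD(1)[OF f(1)]
    by (metis compact_continuous_image compact_Int_closed continuous_on_subset inf_top_left subset_UNIV)
  then obtain e where e: "e > 0" "(\<Union>x\<in>f ` K. ball x e) \<subseteq> V"
    using compact_subset_open_imp_ball_epsilon_subset[OF _ O f(2)] by metis
  show "\<exists>e>0. \<forall>g\<in>Homeo. dist_C0 f g < e \<longrightarrow> g ` K \<subseteq> V"
  proof (intro exI[of _ e] conjI ballI impI e(1) subsetI)
    fix g y assume g: "dist_C0 f g < e" "y \<in> g ` K"
    then obtain x where x: "x \<in> K" "y = g x" by blast
    have "dist (f x) (g x) < e"
      using dist_le_dist_C0[OF cpt, of f x g] g(1) by linarith
    then have "g x \<in> ball (f x) e" by simp
    then show "y \<in> V" using e(2) x by blast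
  qed
qed

lemma openin_Homeo_vimage_inv:
  assumes "openin (Homeo_topology :: ('a \<Rightarrow> 'a) topology) N"
  shows "openin Homeo_topology {g \<in> Homeo. inv g \<in> N}"
  using assms unfolding openin_Homeo_topology_iff
  by (smt (verit, ccfv_threshold) dist_C0_inv inv_in_Homeo mem_Collect_eq subsetI)

lemma closure_of_Homeo_topology_eq:
  assumes "\<And>f e. f \<in> Homeo \<Longrightarrow> e > 0 \<Longrightarrow> \<exists>g\<in>R. g \<in> Homeo \<and> dist_C0 f g < e"
  shows "(Homeo_topology :: ('a \<Rightarrow> 'a) topology) closure_of R = Homeo"
  using assms unfolding Homeo_topology_def H.metric_closure_of by fastforce

end

section \<open>Closing orbits and creating attracting discs\<close>

text \<open>
  In polar coordinates around \<open>c\<close> the map is \<open>t \<mapsto> t * (t / R) ^ m\<close> on the radius. It fixes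
  the sphere of radius \<open>R\<close>, and for large \<open>m\<close> it crushes every smaller ball as far as desired.
\<close>

lemma radial_contraction:
  fixes c :: "'v::euclidean_space"
  assumes "0 < \<rho>" "\<rho> < R" "0 < \<delta>"
  obtains k where "continuous_on (cball c R) k" "bij_betw k (cball c R) (cball c R)"
    "\<And>x. x \<in> sphere c R \<Longrightarrow> k x = x" "k ` cball c \<rho> \<subseteq> ball c \<delta>"
proof -
  obtain m where m: "(\<rho> / R) ^ m < \<delta> / \<rho>"
    using real_arch_pow_inv[of "\<delta> / \<rho>" "\<rho> / R"] assms by auto
  have R: "R > 0" using assms by simp
  define k where "k x = c + (norm (x - c) / R) ^ m *\<^sub>R (x - c)" for x
  \<comment> \<open>inverse: \<open>s \<mapsto> R * root (m + 1) (s / R)\<close> on the radius\<close>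
  define k' where "k' y = c + (root (Suc m) (norm (y - c) / R) * R / norm (y - c)) *\<^sub>R (y - c)" for y
  have norm_k: "norm (k x - c) = (norm (x - c) / R) ^ m * norm (x - c)" for x
    using R by (simp add: k_def)
  have norm_k': "norm (k' x - c) = root (Suc m) (norm (x - c) / R) * R" for x
    using R by (cases "x = c") (simp_all add: k'_def abs_mult real_root_ge_zero)
  have kk': "k' (k x) = x" for x
  proof (cases "x = c")
    case False
    then have t: "norm (x - c) > 0" by simp
    have "norm (k x - c) / R = (norm (x - c) / R) ^ Suc m"
      by (simp add: norm_k)
    then have "root (Suc m) (norm (k x - c) / R) = norm (x - c) / R"
      using R by (simp only:) (rule real_root_power_cancel, auto)
    then have "k' (k x) = c + (norm (x - c) / norm (k x - c)) *\<^sub>R (k x - c)"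
      using R by (simp add: k'_def)
    also have "\<dots> = x"
      using t R by (simp add: norm_k) (simp add: k_def)
    finally show ?thesis .
  qed (simp add: k_def k'_def)
  have k'k: "k (k' y) = y" for y
  proof (cases "y = c")
    case False
    then have t: "norm (y - c) > 0" by simp
    have "(root (Suc m) (norm (y - c) / R)) ^ Suc m = norm (y - c) / R"
      using R by (intro real_root_pow_pos2) auto
    then have *: "root (Suc m) (norm (y - c) / R) ^ m * root (Suc m) (norm (y - c) / R) = norm (y - c) / R"
      by (simp add: mult.commute)
    have "k (k' y) = c + root (Suc m) (norm (y - c) / R) ^ m *\<^sub>R (k' y - c)"
      using R by (simp add: k_def[of "k' y"] norm_k')
    also have "\<dots> = c + (root (Suc m) (norm (y - c) / R) ^ m * root (Suc m) (norm (y - c) / R) * R / norm (y - c)) *\<^sub>R (y - c)"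
      by (simp add: k'_def mult.assoc)
    also have "\<dots> = y"
      unfolding * using t R by simp
    finally show ?thesis .
  qed (simp add: k_def k'_def)
  show ?thesis
  proof
    show "continuous_on (cball c R) k"
      unfolding k_def using R by (intro continuous_intros) auto
    show "bij_betw k (cball c R) (cball c R)"
    proof (rule bij_betw_byWitness[where f' = k'])
      show "k ` cball c R \<subseteq> cball c R"
      proof clarsimp
        fix x assume "dist c x \<le> R"
        then have t: "norm (x - c) \<le> R" by (simp add: dist_norm norm_minus_commute)
        then have "(norm (x - c) / R) ^ m \<le> 1" using R by (intro power_le_one) auto
        then have "norm (k x - c) \<le> 1 * norm (x - c)"
          unfolding norm_k by (rule mult_right_mono) simp
        with t show "dist c (k x) \<le> R" by (simp add: dist_norm norm_minus_commute)
      qed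
      show "k' ` cball c R \<subseteq> cball c R"
      proof clarsimp
        fix x assume "dist c x \<le> R"
        then have t: "norm (x - c) / R \<le> 1" using R by (simp add: dist_norm norm_minus_commute)
        then have "root (Suc m) (norm (x - c) / R) \<le> 1" by simp
        then have "norm (k' x - c) \<le> 1 * R"
          unfolding norm_k' using R by (intro mult_right_mono) auto
        then show "dist c (k' x) \<le> R" by (simp add: dist_norm norm_minus_commute)
      qed
    qed (use kk' k'k in auto)
    show "k x = x" if "x \<in> sphere c R" for x
      using that R by (simp add: k_def dist_norm norm_minus_commute)
    show "k ` cball c \<rho> \<subseteq> ball c \<delta>"
    proof clarsimp
      fix x assume "dist c x \<le> \<rho>"
      then have t: "norm (x - c) \<le> \<rho>" by (simp add: dist_norm norm_minus_commute)
      have "norm (k x - c) \<le> (\<rho> / R) ^ m * \<rho>"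
        unfolding norm_k using t R assms(1) by (intro mult_mono power_mono divide_right_mono) auto
      also have "\<dots> < \<delta>" using m assms(1) by (simp add: field_simps)
      finally show "dist c (k x) < \<delta>" by (simp add: dist_norm norm_minus_commute)
    qed
  qed
qed

lemma homeomorphism_open_image:
  assumes "homeomorphism U V \<phi> \<psi>" "open V" "open B" "B \<subseteq> U"
  shows "open (\<phi> ` B)"
proof -
  have "openin (top_of_set V) (\<phi> ` B)"
    using homeomorphism_imp_open_map[OF assms(1)] open_subset[OF assms(4,3)] by blast
  then show ?thesis using assms(2) by (simp add: openin_open_eq)
qed

text \<open>
  Transport of the radial contraction to the manifold by a chart. Since it is the identity on the
  bounding sphere, extending it by the identity outside the coordinate ball is continuous.
\<close>

lemma local_contraction:
  fixes \<phi> :: "'a::metric_space \<Rightarrow> 'v::euclidean_space"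
  assumes cpt: "compact (UNIV :: 'a set)"
    and hom: "homeomorphism U V \<phi> \<psi>" and "open U" and sub: "cball c R \<subseteq> V"
    and "0 < \<rho>" "\<rho> < R" "0 < \<delta>"
  obtains h where "h \<in> Homeo" "\<And>x. x \<notin> \<psi> ` cball c R \<Longrightarrow> h x = x"
    "h ` (\<psi> ` cball c R) = \<psi> ` cball c R" "h ` (\<psi> ` cball c \<rho>) \<subseteq> \<psi> ` ball c \<delta>"
proof -
  obtain k where k: "continuous_on (cball c R) k" "bij_betw k (cball c R) (cball c R)"
    "\<And>x. x \<in> sphere c R \<Longrightarrow> k x = x" "k ` cball c \<rho> \<subseteq> ball c \<delta>"
    using radial_contraction assms(5-7) by metis
  define K where "K = \<psi> ` cball c R"
  have \<phi>\<psi>: "\<phi> (\<psi> v) = v" if "v \<in> cball c R" for v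
    using hom sub that by (auto simp: homeomorphism_def)
  have cont: "continuous_on U \<phi>" "continuous_on V \<psi>" and "K \<subseteq> U"
    using hom sub by (auto simp: homeomorphism_def K_def)
  have \<phi>K: "\<phi> ` K = cball c R"
    using \<phi>\<psi> by (auto simp: K_def image_image)
  have "compact K"
    unfolding K_def using cont(2) sub by (intro compact_continuous_image) (auto intro: continuous_on_subset)
  then have "closed K" by (rule compact_imp_closed)
  have "open (\<psi> ` ball c R)"
    using homeomorphism_open_image[OF homeomorphism_symD[OF hom] \<open>open U\<close>] sub
    by (metis ball_subset_cball open_ball subset_trans)
  define h where "h x = (if x \<in> K then \<psi> (k (\<phi> x)) else x)" for x
  have hK: "continuous_on K h"
  proof -
    have "continuous_on K (\<lambda>x. \<psi> (k (\<phi> x)))"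
    proof (rule continuous_on_compose2[OF cont(2)])
      show "continuous_on K (\<lambda>x. k (\<phi> x))"
        using \<phi>K \<open>K \<subseteq> U\<close> cont(1)
        by (intro continuous_on_compose2[OF k(1)]) (auto intro: continuous_on_subset)
      show "(\<lambda>x. k (\<phi> x)) ` K \<subseteq> V"
        using \<phi>K k(2) sub by (auto simp: bij_betw_def)
    qed
    then show ?thesis
      by (rule continuous_on_eq) (simp add: h_def)
  qed
  have id: "h x = x" if "x \<in> - \<psi> ` ball c R" for x
  proof (cases "x \<in> K")
    case True
    then obtain v where v: "v \<in> cball c R" "x = \<psi> v" by (auto simp: K_def)
    with that have "v \<in> sphere c R" by (auto simp: less_le)
    with v True k(3) \<phi>\<psi> show ?thesis by (simp add: h_def)
  qed (simp add: h_def)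
  have "continuous_on (- \<psi> ` ball c R) h"
    by (rule continuous_on_eq[OF continuous_on_id]) (simp add: id)
  moreover have "K \<union> - \<psi> ` ball c R = UNIV"
    by (auto simp: K_def)
  ultimately have "continuous_on UNIV h"
    using continuous_on_closed_Un[OF \<open>closed K\<close> _ hK, of "- \<psi> ` ball c R"] \<open>open (\<psi> ` ball c R)\<close>
    by (simp add: closed_Compl)
  moreover have bijK: "bij_betw h K K"
  proof -
    have "bij_betw \<phi> K (cball c R)"
      using \<phi>K hom \<open>K \<subseteq> U\<close> by (auto simp: bij_betw_def homeomorphism_def inj_on_def) (metis subsetD)
    moreover have "bij_betw \<psi> (cball c R) K"
      using inj_on_inverseI[of "cball c R" \<phi> \<psi>] \<phi>\<psi> by (simp add: bij_betw_def K_def)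
    ultimately have "bij_betw (\<psi> \<circ> (k \<circ> \<phi>)) K K"
      using k(2) by (meson bij_betw_trans)
    then show ?thesis
      by (rule bij_betw_cong[THEN iffD1, rotated]) (simp add: h_def)
  qed
  moreover have "bij_betw h (- K) (- K)"
    using bij_betw_id by (rule bij_betw_cong[THEN iffD1, rotated]) (simp add: h_def)
  ultimately have "h \<in> Homeo"
    using bij_betw_combine[of h K K "- K" "- K"] by (intro Homeo_compactI cpt) auto
  then show ?thesis
  proof (rule that)
    show "h x = x" if "x \<notin> \<psi> ` cball c R" for x
      using that by (simp add: h_def K_def)
    show "h ` (\<psi> ` cball c R) = \<psi> ` cball c R"
      using bijK by (simp add: bij_betw_def K_def)
    have "h (\<psi> v) = \<psi> (k v)" if "v \<in> cball c \<rho>" for v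
      using that \<open>\<rho> < R\<close> \<phi>\<psi>[of v] by (auto simp: h_def K_def)
    then show "h ` (\<psi> ` cball c \<rho>) \<subseteq> \<psi> ` ball c \<delta>"
      using k(4) by (auto simp: image_image)
  qed
qed

text \<open>
  Continuity pulls a neighbourhood of \<open>(f ^^ n) x\<close> back along the orbit segment, shrinking it at
  each step so that even closures map into the next neighbourhood. The strict nesting is what
  allows every single step to be perturbed.
\<close>

lemma nested_neighbourhood_chain:
  fixes f :: "'a::metric_space \<Rightarrow> 'a"
  assumes "continuous_on UNIV f"
    and "\<And>j. j \<le> n \<Longrightarrow> open (T j) \<and> (f ^^ j) x \<in> T j"
  shows "\<exists>V. \<forall>j\<le>n. open (V j) \<and> (f ^^ j) x \<in> V j \<and> closure (V j) \<subseteq> T j \<and>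
           (j < n \<longrightarrow> f ` closure (V j) \<subseteq> V (Suc j))"
  using assms(2)
proof (induction n arbitrary: x T)
  case 0
  then obtain e where "e > 0" "cball x e \<subseteq> T 0"
    using open_contains_cball[of "T 0"] by auto
  moreover have "closure (ball x e) \<subseteq> cball x e"
    by (simp add: closure_minimal)
  ultimately show ?case
    by (intro exI[of _ "\<lambda>_. ball x e"]) auto
next
  case (Suc n)
  have "\<And>j. j \<le> n \<Longrightarrow> open (T (Suc j)) \<and> (f ^^ j) (f x) \<in> T (Suc j)"
    using Suc.prems by (metis Suc_le_mono comp_apply funpow_Suc_right)
  from Suc.IH[OF this] obtain V where V: "\<forall>j\<le>n. open (V j) \<and> (f ^^ j) (f x) \<in> V j \<and>
      closure (V j) \<subseteq> T (Suc j) \<and> (j < n \<longrightarrow> f ` closure (V j) \<subseteq> V (Suc j))"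
    by metis
  have "open (T 0 \<inter> f -` V 0)" "x \<in> T 0 \<inter> f -` V 0"
    using Suc.prems[of 0] V[rule_format, of 0] open_vimage[OF _ assms(1)] by auto
  then obtain e where e: "e > 0" "cball x e \<subseteq> T 0 \<inter> f -` V 0"
    by (metis open_contains_cball)
  have cl: "closure (ball x e) \<subseteq> cball x e"
    by (simp add: closure_minimal)
  show ?case
  proof (intro exI[of _ "case_nat (ball x e) V"] allI impI)
    fix j assume "j \<le> Suc n"
    then show "open (case_nat (ball x e) V j) \<and> (f ^^ j) x \<in> case_nat (ball x e) V j \<and>
        closure (case_nat (ball x e) V j) \<subseteq> T j \<and>
        (j < Suc n \<longrightarrow> f ` closure (case_nat (ball x e) V j) \<subseteq> case_nat (ball x e) V (Suc j))"
    proof (cases j)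
      case 0
      have "f ` closure (ball x e) \<subseteq> V 0" "closure (ball x e) \<subseteq> T 0"
        using cl e(2) by auto
      with 0 e(1) show ?thesis by simp
    next
      case (Suc i)
      with V \<open>j \<le> Suc n\<close> show ?thesis
        by (simp add: funpow_Suc_right del: funpow.simps)
    qed
  qed
qed

text \<open>
  By compactness the orbit of \<open>y\<close> accumulates at some \<open>p\<close>, so two points of the orbit, \<open>x\<close> and a
  later one, lie in a small coordinate ball around \<open>p\<close>. Recentre the ball at \<open>x\<close> and let \<open>n\<close> be the
  first return time. The intermediate points avoid the ball, so a perturbation supported there
  affects only the last step of the orbit segment. The two radii \<open>\<rho> < R\<close> leave room for an
  annulus in which this perturbation can fade out to the identity.
\<close>

lemma returning_orbit:
  fixes f :: "'a::metric_space \<Rightarrow> 'a"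
  assumes cpt: "compact (UNIV :: 'a set)"
    and chart: "\<And>p :: 'a. \<exists>U (V :: 'v::euclidean_space set) \<phi> \<psi>.
      p \<in> U \<and> open U \<and> open V \<and> homeomorphism U V \<phi> \<psi>"
    and "e > 0"
  obtains U and V :: "'v::euclidean_space set" and \<phi> \<psi> x i n \<rho> R
  where "open U" "open V" "homeomorphism U V \<phi> \<psi>" "x \<in> U" "x = (f ^^ i) y"
    "0 < \<rho>" "\<rho> < R" "cball (\<phi> x) R \<subseteq> V"
    "\<And>a b. a \<in> \<psi> ` cball (\<phi> x) R \<Longrightarrow> b \<in> \<psi> ` cball (\<phi> x) R \<Longrightarrow> dist a b < e"
    "n > 0" "(f ^^ n) x \<in> \<psi> ` ball (\<phi> x) \<rho>"
    "\<And>j. 0 < j \<Longrightarrow> j < n \<Longrightarrow> (f ^^ j) x \<notin> \<psi> ` cball (\<phi> x) R"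
proof -
  obtain p and s :: "nat \<Rightarrow> nat" where s: "strict_mono s" "((\<lambda>i. (f ^^ i) y) \<circ> s) \<longlonglongrightarrow> p"
    using cpt unfolding compact_def by (metis UNIV_I)
  obtain U and V :: "'v::euclidean_space set" and \<phi> \<psi> where U: "p \<in> U" "open U" "open V" "homeomorphism U V \<phi> \<psi>"
    using chart by metis
  have \<phi>\<psi>: "\<And>v. v \<in> V \<Longrightarrow> \<phi> (\<psi> v) = v \<and> \<psi> v \<in> U" "\<And>u. u \<in> U \<Longrightarrow> \<psi> (\<phi> u) = u \<and> \<phi> u \<in> V"
    using U(4) by (auto simp: homeomorphism_def)
  define W where "W = U \<inter> ball p (e / 2)"
  have "open (\<phi> ` W)" "p \<in> W"
    using U \<open>e > 0\<close> by (auto simp: W_def intro!: homeomorphism_open_image[OF U(4)])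
  then obtain r0 where r0: "r0 > 0" "cball (\<phi> p) r0 \<subseteq> \<phi> ` W"
    by (meson imageI open_contains_cball)
  \<comment> \<open>a ball of radius \<open>3 * r\<close> around a point within \<open>r\<close> of \<open>\<phi> p\<close> must still lie in the chart\<close>
  define r where "r = r0 / 4"
  have r: "r > 0" "cball (\<phi> p) (4 * r) \<subseteq> \<phi> ` W" using r0 by (auto simp: r_def)
  have WV: "\<phi> ` W \<subseteq> V" "\<psi> ` \<phi> ` W \<subseteq> ball p (e / 2)"
    using \<phi>\<psi> by (auto simp: W_def)
  have "ball (\<phi> p) r \<subseteq> cball (\<phi> p) (4 * r)" using r by auto
  then have "ball (\<phi> p) r \<subseteq> V" using r WV by blast
  then have "open (\<psi> ` ball (\<phi> p) r)"
    using homeomorphism_open_image[OF homeomorphism_symD[OF U(4)] U(2)] by simp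
  moreover have "p \<in> \<psi> ` ball (\<phi> p) r"
    using \<phi>\<psi>(2)[OF U(1)] r(1) by (metis centre_in_ball imageI)
  ultimately have "\<forall>\<^sub>F k in sequentially. (f ^^ s k) y \<in> \<psi> ` ball (\<phi> p) r"
    using topological_tendstoD[OF s(2)] by (simp add: comp_def)
  then obtain k where k: "\<And>l. l \<ge> k \<Longrightarrow> (f ^^ s l) y \<in> \<psi> ` ball (\<phi> p) r"
    by (auto simp: eventually_sequentially)
  define x where "x = (f ^^ s k) y"
  obtain c where c: "c \<in> ball (\<phi> p) r" "x = \<psi> c" using k[of k] by (auto simp: x_def)
  then have "c \<in> V" using \<open>ball (\<phi> p) r \<subseteq> V\<close> by blast
  then have \<phi>x: "\<phi> x = c" "x \<in> U" using c \<phi>\<psi> by auto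
  have sub: "cball c (3 * r) \<subseteq> cball (\<phi> p) (4 * r)"
  proof
    fix v assume "v \<in> cball c (3 * r)"
    then show "v \<in> cball (\<phi> p) (4 * r)"
      using c(1) dist_triangle[of "\<phi> p" v c] by simp
  qed
  define ret where "ret n \<longleftrightarrow> n > 0 \<and> (f ^^ n) x \<in> \<psi> ` cball c (2 * r)" for n
  have "ret (s (Suc k) - s k)"
  proof -
    have less: "s k < s (Suc k)" using s(1) by (simp add: strict_mono_def)
    have "(f ^^ (s (Suc k) - s k)) x = (f ^^ s (Suc k)) y"
      using less funpow_add[of "s (Suc k) - s k" "s k" f] by (simp add: x_def)
    moreover have "ball (\<phi> p) r \<subseteq> cball c (2 * r)"
    proof
      fix v assume "v \<in> ball (\<phi> p) r"
      then show "v \<in> cball c (2 * r)"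
        using c(1) dist_triangle2[of c v "\<phi> p"] by (simp add: dist_commute)
    qed
    ultimately show ?thesis
      using k[of "Suc k"] less by (auto simp: ret_def)
  qed
  define n where "n = (LEAST n. ret n)"
  have n: "ret n" "\<And>j. j < n \<Longrightarrow> \<not> ret j"
    unfolding n_def by (rule LeastI[of ret, OF \<open>ret _\<close>]) (rule not_less_Least)
  \<comment> \<open>distances of the points before the return, all greater than \<open>2 * r\<close>; a radius \<open>R\<close> below
    them keeps these points out of the larger ball too\<close>
  define F where "F = insert (3 * r) ((\<lambda>j. dist c (\<phi> ((f ^^ j) x))) ` {j. 0 < j \<and> j < n \<and> (f ^^ j) x \<in> U})"
  have "finite F" by (simp add: F_def)
  have F: "2 * r < d" if "d \<in> F" for d
  proof (rule ccontr)
    assume "\<not> 2 * r < d"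
    with that r(1) obtain j where j: "0 < j" "j < n" "(f ^^ j) x \<in> U" "dist c (\<phi> ((f ^^ j) x)) \<le> 2 * r"
      by (auto simp: F_def)
    then have "(f ^^ j) x \<in> \<psi> ` cball c (2 * r)"
      using \<phi>\<psi>(2)[OF j(3)] by (intro image_eqI[of _ _ "\<phi> ((f ^^ j) x)"]) auto
    with j(1) have "ret j" by (simp add: ret_def)
    with n(2) j show False by blast
  qed
  define R where "R = (2 * r + Min F) / 2"
  have Min: "2 * r < Min F" "Min F \<le> 3 * r"
    using F \<open>finite F\<close> by (auto simp: F_def)
  then have R: "2 * r < R" "R < Min F" "R < 3 * r" by (auto simp: R_def)
  have RW: "cball c R \<subseteq> \<phi> ` W"
    using sub r(2) R(3) by (meson less_imp_le order_trans subset_cball)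
  obtain \<rho> where \<rho>: "2 * r < \<rho>" "\<rho> < R" using R dense by blast
  show ?thesis
  proof (rule that[OF U(2-4) \<phi>x(2) x_def, of \<rho> R n]; (unfold \<phi>x(1))?)
    show "0 < \<rho>" "\<rho> < R" "n > 0" using r(1) \<rho> n(1) by (auto simp: ret_def)
    show "cball c R \<subseteq> V" using RW WV by blast
    show "dist a b < e" if "a \<in> \<psi> ` cball c R" "b \<in> \<psi> ` cball c R" for a b
    proof -
      have "a \<in> ball p (e / 2)" "b \<in> ball p (e / 2)" using that RW WV(2) by blast+
      then show ?thesis using dist_triangle_half_r[of p a e b] by simp
    qed
    have "cball c (2 * r) \<subseteq> ball c \<rho>" using \<rho> by auto
    then show "(f ^^ n) x \<in> \<psi> ` ball c \<rho>" using n(1) unfolding ret_def by blast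
    show "(f ^^ j) x \<notin> \<psi> ` cball c R" if j: "0 < j" "j < n" for j
    proof
      assume "(f ^^ j) x \<in> \<psi> ` cball c R"
      then obtain v where v: "v \<in> cball c R" "(f ^^ j) x = \<psi> v" by blast
      then have "v \<in> V" using RW WV(1) by blast
      then have "dist c v \<in> F"
        using j v(2) \<phi>\<psi>(1)[OF \<open>v \<in> V\<close>] unfolding F_def by (intro insertI2 image_eqI[of _ _ j]) auto
      then have "Min F \<le> dist c v" using \<open>finite F\<close> by simp
      with v(1) R show False by simp
    qed
  qed
qed

lemma continuous_on_funpow:
  fixes f :: "'a::topological_space \<Rightarrow> 'a"
  assumes "continuous_on UNIV f"
  shows "continuous_on S (f ^^ n)"
proof (induction n)
  case (Suc n)
  then show ?case
    using continuous_on_compose2[OF assms Suc] by (simp add: comp_def)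
qed (simp add: id_def)

lemma infinite_chart_domain:
  fixes V :: "'v::euclidean_space set"
  assumes "homeomorphism U V \<phi> \<psi>" "open V" "V \<noteq> {}"
  shows "infinite U"
proof
  assume "finite U"
  then have "finite V" using assms(1) by (metis finite_imageI homeomorphism_def)
  then show False
    using assms(2,3) finite_imp_not_open by blast
qed

text \<open>
  Take a returning orbit segment \<open>x, \<dots>, (f ^^ n) x\<close> in \<open>C\<close> and compose \<open>f\<close> with a contraction \<open>h\<close>
  supported in the small coordinate ball where \<open>x\<close> and \<open>(f ^^ n) x\<close> lie. The contraction moves
  points by at most the diameter of the ball, and it sends a neighbourhood of \<open>(f ^^ n) x\<close> into a
  tiny disc \<open>D\<close> around \<open>x\<close>. With neighbourhoods \<open>S j\<close> of the points of the segment this reads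
  \<open>g ` closure (S j) \<subseteq> S (j + 1)\<close> for the steps before the last, and the last step lands in
  the interior of \<open>D \<subseteq> S 0\<close>.

  These finitely many inclusions of a compact set in an open one define the open set \<open>N\<close>. Every
  map in \<open>N\<close> traps the union \<open>W\<close> of the \<open>S j\<close>, and its \<open>n\<close>-th iterate maps \<open>D\<close> into itself, so it
  has a fixed point in \<open>D\<close> by Brouwer's theorem. The invariance \<open>f ` C \<subseteq> C\<close> places the
  attractor inside \<open>C\<close>.
\<close>

lemma exists_robust_attractor_nearby:
  fixes f :: "'a::metric_space \<Rightarrow> 'a"
  assumes cpt: "compact (UNIV :: 'a set)"
    and chart: "\<And>p :: 'a. \<exists>U (V :: 'v::euclidean_space set) \<phi> \<psi>.
      p \<in> U \<and> open U \<and> open V \<and> homeomorphism U V \<phi> \<psi>"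
    and f: "f \<in> Homeo" and C: "open C" "C \<noteq> {}" "f ` C \<subseteq> C" and "e > 0"
  obtains g N W where "openin Homeo_topology N" "g \<in> N" "dist_C0 f g < e"
    "open W" "W \<subseteq> C" "W \<noteq> UNIV"
    "\<And>h. h \<in> N \<Longrightarrow> h ` closure W \<subseteq> W \<and> (\<exists>x\<in>W. \<exists>n>0. (h ^^ n) x = x)"
proof -
  note fH = HomeoD[OF f]
  \<comment> \<open>since \<open>inv (h \<circ> f) = inv f \<circ> inv h\<close>, closeness of the inverses needs a modulus of continuity for \<open>inv f\<close>\<close>
  have "uniformly_continuous_on UNIV (inv f)"
    using fH(2) cpt by (rule compact_uniformly_continuous)
  then obtain e1 where e1: "e1 > 0" "\<And>a b. dist a b < e1 \<Longrightarrow> dist (inv f a) (inv f b) < e / 2"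
    using \<open>e > 0\<close> unfolding uniformly_continuous_on_def by (metis UNIV_I half_gt_zero)
  obtain y where "y \<in> C" using C by blast
  have "min e1 (e / 2) > 0" using e1 \<open>e > 0\<close> by simp
  from returning_orbit[OF cpt chart this, of f y]
  obtain U and V :: "'v::euclidean_space set" and \<phi> \<psi> x i n \<rho> R
    where U: "open U" "open V" "homeomorphism U V \<phi> \<psi>" "x \<in> U" and x: "x = (f ^^ i) y"
    and R: "0 < \<rho>" "\<rho> < R" "cball (\<phi> x) R \<subseteq> V"
    and diam: "\<And>a b. a \<in> \<psi> ` cball (\<phi> x) R \<Longrightarrow> b \<in> \<psi> ` cball (\<phi> x) R \<Longrightarrow> dist a b < min e1 (e / 2)"
    and n: "n > 0" "(f ^^ n) x \<in> \<psi> ` ball (\<phi> x) \<rho>"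
      "\<And>j. 0 < j \<Longrightarrow> j < n \<Longrightarrow> (f ^^ j) x \<notin> \<psi> ` cball (\<phi> x) R"
    by metis
  define c where "c = \<phi> x"
  define K where "K = \<psi> ` cball c R"
  have \<phi>\<psi>: "\<And>v. v \<in> V \<Longrightarrow> \<phi> (\<psi> v) = v \<and> \<psi> v \<in> U" "\<And>u. u \<in> U \<Longrightarrow> \<psi> (\<phi> u) = u \<and> \<phi> u \<in> V"
    and cont: "continuous_on U \<phi>" "continuous_on V \<psi>"
    using U(3) by (auto simp: homeomorphism_def)
  have inC: "(f ^^ j) y \<in> C" for j
    using \<open>y \<in> C\<close> C(3) by (induction j) auto
  have xC: "(f ^^ j) x \<in> C" for j
    using inC[of "j + i"] by (simp add: x funpow_add)
  have "closed K"
    unfolding K_def c_def using cont(2) R(3)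
    by (intro compact_imp_closed compact_continuous_image) (auto intro: continuous_on_subset)
  have open_\<psi>: "open (\<psi> ` ball c d)" if "d \<le> R" for d
    using that R(3) U by (intro homeomorphism_open_image[OF homeomorphism_symD[OF U(3)] U(1)]) (auto simp: c_def subset_iff)
  have "infinite (UNIV :: 'a set)"
    using infinite_chart_domain[OF U(3,2)] U(4) \<phi>\<psi>(2) by (metis empty_iff finite_subset subset_UNIV)
  \<comment> \<open>a point to be left outside \<open>W\<close>: the complement of the attractor must not be empty\<close>
  then obtain z where z: "z \<notin> (\<lambda>j. (f ^^ j) x) ` {..<n}"
    by (metis ex_new_if_finite finite_imageI finite_lessThan)
  \<comment> \<open>outside \<open>K\<close> the contraction \<open>h\<close> will be the identity, so the intermediate steps of \<open>f\<close> survive\<close>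
  define T where "T j = (if j = n then \<psi> ` ball c \<rho> else if j = 0 then C - {z} else C - {z} - K)" for j
  have T: "open (T j) \<and> (f ^^ j) x \<in> T j" if "j \<le> n" for j
  proof
    show "open (T j)"
      using open_\<psi>[of \<rho>] R(2) C(1) \<open>closed K\<close> by (auto simp: T_def)
    have "(f ^^ j) x \<noteq> z" if "j < n"
      using z that by blast
    then show "(f ^^ j) x \<in> T j"
      using \<open>j \<le> n\<close> n(2) n(3)[of j] xC[of j] unfolding T_def K_def c_def by auto
  qed
  obtain S where S: "\<And>j. j \<le> n \<Longrightarrow> open (S j) \<and> (f ^^ j) x \<in> S j \<and> closure (S j) \<subseteq> T j \<and>
      (j < n \<longrightarrow> f ` closure (S j) \<subseteq> S (Suc j))"
    using nested_neighbourhood_chain[OF fH(1), of n T x] T by auto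
  have "open (\<phi> ` (S 0 \<inter> U))" "c \<in> \<phi> ` (S 0 \<inter> U)"
    using S[of 0] U by (auto simp: c_def intro!: homeomorphism_open_image[OF U(3,2)])
  then obtain \<delta> where \<delta>: "\<delta> > 0" "cball c \<delta> \<subseteq> \<phi> ` (S 0 \<inter> U)"
    by (meson open_contains_cball)
  have \<delta>V: "cball c \<delta> \<subseteq> V" and \<delta>S: "\<psi> ` cball c \<delta> \<subseteq> S 0"
    using \<delta>(2) \<phi>\<psi> by force+
  have open_D: "open (\<psi> ` ball c \<delta>)"
    using \<delta>V ball_subset_cball
    by (intro homeomorphism_open_image[OF homeomorphism_symD[OF U(3)] U(1)]) blast+
  obtain h where h: "h \<in> Homeo" "\<And>x. x \<notin> K \<Longrightarrow> h x = x" "h ` K = K"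
      "h ` (\<psi> ` cball c \<rho>) \<subseteq> \<psi> ` ball c \<delta>"
    using local_contraction[OF cpt U(3,1) _ R(1,2) \<delta>(1), of c] R(3) unfolding K_def c_def by metis
  note hH = HomeoD[OF h(1)]
  define g where "g = h \<circ> f"
  have gH: "g \<in> Homeo"
    unfolding g_def using fH hH
    by (intro Homeo_compactI cpt bij_comp continuous_on_compose) (auto intro: continuous_on_subset)
  have move: "dist y (h y) < min e1 (e / 2)" for y
    using h(2)[of y] h(3) diam[of y "h y"] e1(1) \<open>e > 0\<close> by (cases "y \<in> K") (auto simp: K_def c_def)
  have "dist_C0 f g \<le> e / 2"
  proof (rule dist_C0_le)
    show "dist (f x) (g x) \<le> e / 2" for x
      using move[of "f x"] by (simp add: g_def)
    have "inv g = inv f \<circ> inv h"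
      unfolding g_def using fH hH by (simp add: o_inv_distrib)
    moreover have "dist x (inv h x) < e1" for x
      using move[of "inv h x"] hH(3) by (simp add: bij_is_surj surj_f_inv_f dist_commute)
    ultimately show "dist (inv f x) (inv g x) \<le> e / 2" for x
      using e1(2) less_imp_le by fastforce
  qed
  then have close: "dist_C0 f g < e" using \<open>e > 0\<close> by simp
  \<comment> \<open>the last step of the cycle lands in the small coordinate ball\<close>
  define S' where "S' j = (if Suc j = n then \<psi> ` ball c \<delta> else S (Suc j))" for j
  define N where "N = (\<Inter>j\<in>{..<n}. {k \<in> Homeo. k ` closure (S j) \<subseteq> S' j})"
  define W where "W = (\<Union>j<n. S j)"
  have "openin Homeo_topology N"
    unfolding N_def using n(1) S open_D
    by (intro openin_INT2 openin_maps_into_open[OF cpt]) (auto simp: S'_def)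
  have gN: "g \<in> N"
  proof -
    have "g ` closure (S j) \<subseteq> S' j" if j: "j < n" for j
    proof (cases "Suc j = n")
      case True
      have "f ` closure (S j) \<subseteq> \<psi> ` cball c \<rho>"
      proof -
        have "f ` closure (S j) \<subseteq> S (Suc j)" "S (Suc j) \<subseteq> \<psi> ` ball c \<rho>"
          using S[of j] S[of "Suc j"] closure_subset[of "S (Suc j)"] True by (auto simp: T_def)
        then show ?thesis using ball_subset_cball[of c \<rho>] by blast
      qed
      then show ?thesis
        using order_trans[OF image_mono h(4)] True unfolding S'_def g_def image_comp[symmetric] by simp
    next
      case False
      with j have "f ` closure (S j) \<subseteq> S (Suc j)" "S (Suc j) \<inter> K = {}"
        using S[of j] S[of "Suc j"] closure_subset[of "S (Suc j)"] by (auto simp: T_def)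
      then have "g u \<in> S (Suc j)" if "u \<in> closure (S j)" for u
        using that h(2)[of "f u"] unfolding g_def by (metis comp_apply disjoint_iff image_subset_iff)
      then show ?thesis using False by (auto simp: S'_def)
    qed
    then show ?thesis using gH by (auto simp: N_def)
  qed
  have SW: "S j \<subseteq> W" if "j < n" for j using that by (auto simp: W_def)
  have "open W" using S by (auto simp: W_def)
  have "W \<subseteq> C - {z}"
  proof -
    have "S j \<subseteq> C - {z}" if "j < n" for j
      using that S[of j] closure_subset[of "S j"] by (auto simp: T_def split: if_splits)
    then show ?thesis by (auto simp: W_def)
  qed
  have "k ` closure W \<subseteq> W \<and> (\<exists>x\<in>W. \<exists>n>0. (k ^^ n) x = x)" if "k \<in> N" for k
  proof
    have kH: "k \<in> Homeo" and k: "\<And>j. j < n \<Longrightarrow> k ` closure (S j) \<subseteq> S' j"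
      using that n(1) by (auto simp: N_def)
    have D: "\<psi> ` ball c \<delta> \<subseteq> S 0" using \<delta>S ball_subset_cball by blast
    have "S' j \<subseteq> W" if "j < n" for j
      using that SW[of "Suc j"] SW[of 0] D by (auto simp: S'_def)
    moreover have "closure W \<subseteq> (\<Union>j<n. closure (S j))"
      unfolding W_def using closure_subset by (intro closure_minimal closed_UN) fastforce+
    ultimately show "k ` closure W \<subseteq> W" using k by blast
    have iter: "(k ^^ j) ` (\<psi> ` cball c \<delta>) \<subseteq> (if j = n then \<psi> ` ball c \<delta> else S j)" if "j \<le> n" for j
      using that
    proof (induction j)
      case 0
      then show ?case using \<delta>S n(1) by simp
    next
      case (Suc j)
      then have "(k ^^ j) ` (\<psi> ` cball c \<delta>) \<subseteq> closure (S j)"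
        using closure_subset[of "S j"] by auto
      then show ?case
        using k[of j] Suc.prems unfolding S'_def by (auto simp: image_subset_iff)
    qed
    have ret: "\<phi> ((k ^^ n) (\<psi> v)) \<in> ball c \<delta> \<and> (k ^^ n) (\<psi> v) \<in> U" if v: "v \<in> cball c \<delta>" for v
    proof -
      have "(k ^^ n) (\<psi> v) \<in> \<psi> ` ball c \<delta>"
        using iter[of n] v by auto
      then obtain w where w: "w \<in> ball c \<delta>" "(k ^^ n) (\<psi> v) = \<psi> w" by blast
      moreover have "w \<in> V" using w(1) \<delta>V by auto
      ultimately show ?thesis using \<phi>\<psi>(1)[of w] by simp
    qed
    have "continuous_on (cball c \<delta>) (\<lambda>v. \<phi> ((k ^^ n) (\<psi> v)))"
    proof (rule continuous_on_compose2[OF cont(1)])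
      show "continuous_on (cball c \<delta>) (\<lambda>v. (k ^^ n) (\<psi> v))"
        using continuous_on_funpow[OF HomeoD(1)[OF kH], of UNIV n] continuous_on_subset[OF cont(2) \<delta>V]
        by (rule continuous_on_compose2) auto
      show "(\<lambda>v. (k ^^ n) (\<psi> v)) ` cball c \<delta> \<subseteq> U"
        using ret by blast
    qed
    moreover have "(\<lambda>v. \<phi> ((k ^^ n) (\<psi> v))) \<in> cball c \<delta> \<rightarrow> cball c \<delta>"
      using ret by (auto simp: Pi_iff intro: less_imp_le)
    moreover have "cball c \<delta> \<noteq> {}" using \<delta>(1) by simp
    ultimately obtain v where v: "v \<in> cball c \<delta>" "\<phi> ((k ^^ n) (\<psi> v)) = v"
      using brouwer[OF compact_cball convex_cball] by blast
    then have "(k ^^ n) (\<psi> v) = \<psi> v"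
      using ret[OF v(1)] \<phi>\<psi>(2) by metis
    then show "\<exists>x\<in>W. \<exists>n>0. (k ^^ n) x = x"
      using v(1) \<delta>S SW[OF n(1)] n(1) by blast
  qed
  moreover have "W \<subseteq> C" "W \<noteq> UNIV"
    using \<open>W \<subseteq> C - {z}\<close> by auto
  ultimately show ?thesis
    using that[OF \<open>openin Homeo_topology N\<close> gN close \<open>open W\<close>] by simp
qed

section \<open>Two robust periodic orbits\<close>

lemma periodic_orbit_in_invariant_set:
  assumes "inj f" "f ` W \<subseteq> W" "x \<in> W" "n > 0" "(f ^^ n) x = x"
  obtains S where "finite S" "S \<noteq> {}" "S \<subseteq> W" "f ` S = S"
proof -
  define S where "S = (\<lambda>j. (f ^^ j) x) ` {..<n}"
  have fin: "finite S" by (simp add: S_def)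
  have "f ` S \<subseteq> S"
  proof (clarsimp simp: S_def)
    fix j assume "j < n"
    show "f ((f ^^ j) x) \<in> (\<lambda>j. (f ^^ j) x) ` {..<n}"
    proof (cases "Suc j = n")
      case True
      then have "f ((f ^^ j) x) = (f ^^ 0) x" using assms(5) by auto
      then show ?thesis using assms(4) by blast
    next
      case False
      with \<open>j < n\<close> have "Suc j < n" by simp
      then show ?thesis by (intro image_eqI[of _ _ "Suc j"]) auto
    qed
  qed
  then have "f ` S = S"
    using fin assms(1) by (intro card_subset_eq) (auto simp: card_image inj_on_subset)
  moreover have "(f ^^ j) x \<in> W" for j
    using assms(2,3) by (induction j) auto
  then have "S \<subseteq> W" by (auto simp: S_def)
  ultimately show ?thesis
    using that[OF fin] assms(4) by (auto simp: S_def)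
qed

text \<open>
  Unlike a pair of periodic points with their periods, this form is symmetric in \<open>f\<close> and \<open>inv f\<close>,
  and it is directly what the invariant measures need.
\<close>

definition two_finite_invariant_sets :: "('a::topological_space \<Rightarrow> 'a) set" where
  "two_finite_invariant_sets = {f \<in> Homeo. \<exists>S T. finite S \<and> S \<noteq> {} \<and> f ` S = S \<and>
     finite T \<and> T \<noteq> {} \<and> f ` T = T \<and> S \<inter> T = {}}"

text \<open>
  A first perturbation \<open>g1\<close> has a robust attractor \<open>W1\<close> with a periodic orbit. The complement \<open>C\<close>
  of its closure is mapped into itself by \<open>inv g1\<close>, so a second perturbation, applied to the inverse,
  creates a robust attractor of the inverse, that is a repeller, inside \<open>C\<close>. Taking
  the second perturbation small enough not to leave \<open>N1\<close> keeps the first attractor. Every map near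
  the result has a periodic orbit in each of two disjoint regions.
\<close>

lemma robust_two_periodic_orbits_nearby:
  fixes f :: "'a::metric_space \<Rightarrow> 'a"
  assumes cpt: "compact (UNIV :: 'a set)"
    and chart: "\<And>p :: 'a. \<exists>U (V :: 'v::euclidean_space set) \<phi> \<psi>.
      p \<in> U \<and> open U \<and> open V \<and> homeomorphism U V \<phi> \<psi>"
    and f: "f \<in> Homeo" and "e > 0"
  obtains g where "g \<in> Homeo_topology interior_of two_finite_invariant_sets" "dist_C0 f g < e"
proof -
  interpret H: Metric_space "Homeo :: ('a \<Rightarrow> 'a) set" dist_C0
    by (rule Metric_space_Homeo[OF cpt])
  have "e / 2 > 0" using \<open>e > 0\<close> by simp
  from exists_robust_attractor_nearby[OF cpt chart f open_UNIV UNIV_not_empty subset_UNIV this]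
  obtain g1 N1 W1 where N1: "openin Homeo_topology N1" "g1 \<in> N1" "dist_C0 f g1 < e / 2"
      and W1: "open W1" "W1 \<noteq> UNIV"
      and P1: "\<And>h. h \<in> N1 \<Longrightarrow> h ` closure W1 \<subseteq> W1 \<and> (\<exists>x\<in>W1. \<exists>n>0. (h ^^ n) x = x)"
    by metis
  obtain d where d: "d > 0" "\<And>g. g \<in> Homeo \<Longrightarrow> dist_C0 g1 g < d \<Longrightarrow> g \<in> N1"
    and g1: "g1 \<in> Homeo"
    using N1(1,2) unfolding openin_Homeo_topology_iff[OF cpt] by blast
  note g1H = HomeoD[OF g1]
  define C where "C = - closure W1"
  have "open C" by (simp add: C_def open_Compl)
  \<comment> \<open>otherwise surjectivity of \<open>g1\<close> would force \<open>W1 = UNIV\<close>\<close>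
  have "C \<noteq> {}"
  proof
    assume "C = {}"
    then have "g1 ` UNIV \<subseteq> W1" using P1[OF N1(2)] by (auto simp: C_def)
    then show False using g1H(3) W1(2) by (auto simp: bij_def)
  qed
  have "inv g1 ` C \<subseteq> C"
  proof clarify
    fix y assume "y \<in> C"
    have "y = g1 (inv g1 y)" using g1H(3) by (simp add: bij_is_surj surj_f_inv_f)
    then have "inv g1 y \<notin> closure W1"
      using P1[OF N1(2)] \<open>y \<in> C\<close> closure_subset[of W1] unfolding C_def by auto
    then show "inv g1 y \<in> C" by (simp add: C_def)
  qed
  moreover have "min d (e / 2) > 0" using d(1) \<open>e > 0\<close> by simp
  ultimately obtain k N2 W2 where N2: "openin Homeo_topology N2" "k \<in> N2" "dist_C0 (inv g1) k < min d (e / 2)"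
      and W2: "W2 \<subseteq> C"
      and P2: "\<And>h. h \<in> N2 \<Longrightarrow> h ` closure W2 \<subseteq> W2 \<and> (\<exists>x\<in>W2. \<exists>n>0. (h ^^ n) x = x)"
    using exists_robust_attractor_nearby[OF cpt chart inv_in_Homeo[OF g1] \<open>open C\<close> \<open>C \<noteq> {}\<close>]
    by metis
  have k: "k \<in> Homeo" using N2(1,2) by (auto simp: openin_Homeo_topology_iff[OF cpt])
  define g where "g = inv k"
  have g: "g \<in> Homeo" "inv g = k" "dist_C0 g1 g < min d (e / 2)"
    using k N2(3) dist_C0_inv[OF inv_in_Homeo[OF g1] k] g1H(3)
    by (auto simp: g_def inv_in_Homeo inv_inv_eq HomeoD)
  define N where "N = N1 \<inter> {h \<in> Homeo. inv h \<in> N2}"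
  have "openin Homeo_topology N"
    unfolding N_def using N1(1) N2(1) openin_Homeo_vimage_inv[OF cpt] by blast
  moreover have "g \<in> N"
    using g d(2) N2(2) by (simp add: N_def)
  moreover have "N \<subseteq> two_finite_invariant_sets"
  proof
    fix h assume h: "h \<in> N"
    then have hH: "h \<in> Homeo" "h \<in> N1" "inv h \<in> N2" by (auto simp: N_def)
    note bij = HomeoD(3)[OF hH(1)]
    obtain x m where x: "h ` W1 \<subseteq> W1" "x \<in> W1" "m > 0" "(h ^^ m) x = x"
      using P1[OF hH(2)] closure_subset[of W1] by blast
    obtain S where S: "finite S" "S \<noteq> {}" "S \<subseteq> W1" "h ` S = S"
      using periodic_orbit_in_invariant_set[OF bij_is_inj[OF bij] x] by metis
    obtain y l where y: "inv h ` W2 \<subseteq> W2" "y \<in> W2" "l > 0" "(inv h ^^ l) y = y"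
      using P2[OF hH(3)] closure_subset[of W2] by blast
    obtain T where T: "finite T" "T \<noteq> {}" "T \<subseteq> W2" "inv h ` T = T"
      using periodic_orbit_in_invariant_set[OF bij_is_inj[OF bij_imp_bij_inv[OF bij]] y] by metis
    have "h ` T = T" using T(4) bij by (metis bij_is_surj image_f_inv_f)
    moreover have "S \<inter> T = {}"
      using S(3) T(3) W2 closure_subset[of W1] by (auto simp: C_def)
    ultimately show "h \<in> two_finite_invariant_sets"
      using S T(1,2) hH(1) unfolding two_finite_invariant_sets_def by blast
  qed
  ultimately have "g \<in> Homeo_topology interior_of two_finite_invariant_sets"
    using interior_of_maximal by blast
  moreover have "dist_C0 f g < e"
    using H.triangle[OF f g1 g(1)] N1(3) g(3) by simp
  ultimately show ?thesis by (rule that)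
qed

section \<open>Generic observables with two different averages\<close>

theorem proposition1:
  fixes A :: "('a::metric_space, 'n::finite) chart set"
    and G :: "('a, 'n) chart \<Rightarrow> real ^ 'n \<Rightarrow> real ^ 'n ^ 'n"
  assumes "riemannian_manifold A G"
    and "compact (UNIV :: 'a set)"
  shows "\<exists>R :: ('a \<Rightarrow> 'a) set. baire_residual Homeo_topology R \<and>
           (\<forall>f\<in>R. \<exists>R_f :: ('a \<Rightarrow>\<^sub>C (real ^ 'd::finite)) set. baire_residual euclidean R_f \<and>
              (\<forall>\<phi>\<in>R_f. \<exists>\<mu>1\<in>invariant_measures f. \<exists>\<mu>2\<in>invariant_measures f.
                 (\<integral>x. apply_bcontfun \<phi> x \<partial>\<mu>1) \<noteq> (\<integral>x. apply_bcontfun \<phi> x \<partial>\<mu>2)))"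
proof -
  note cpt = assms(2)
  have atlas: "smooth_atlas A"
    using assms(1) by (rule riemannian_manifold.smooth_atlas)
  have chart: "\<exists>U (V :: (real ^ 'n) set) \<phi> \<psi>. p \<in> U \<and> open U \<and> open V \<and> homeomorphism U V \<phi> \<psi>"
    for p :: 'a
  proof -
    have "p \<in> (\<Union>(U, \<phi>)\<in>A. U)" using atlas by (simp add: smooth_atlas_def)
    then obtain U \<phi> where "(U, \<phi>) \<in> A" "p \<in> U" by auto
    then show ?thesis using atlas unfolding smooth_atlas_def by blast
  qed
  define R :: "('a \<Rightarrow> 'a) set" where "R = Homeo_topology interior_of two_finite_invariant_sets"
  have "R \<subseteq> Homeo"
    using interior_of_subset_topspace topspace_Homeo_topology[OF cpt] unfolding R_def by metis
  have "Homeo_topology closure_of R = Homeo"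
  proof (rule closure_of_Homeo_topology_eq[OF cpt])
    fix f :: "'a \<Rightarrow> 'a" and e :: real assume "f \<in> Homeo" "e > 0"
    then obtain g where "g \<in> R" "dist_C0 f g < e"
      using robust_two_periodic_orbits_nearby[OF cpt chart] unfolding R_def by metis
    then show "\<exists>g\<in>R. g \<in> Homeo \<and> dist_C0 f g < e"
      using \<open>R \<subseteq> Homeo\<close> by blast
  qed
  then have "baire_residual Homeo_topology R"
    using \<open>R \<subseteq> Homeo\<close> unfolding baire_residual_def topspace_Homeo_topology[OF cpt]
    by (intro conjI exI[of _ "\<lambda>_. R"]) (auto simp: R_def)
  moreover have "\<exists>R_f :: ('a \<Rightarrow>\<^sub>C (real ^ 'd)) set. baire_residual euclidean R_f \<and>
              (\<forall>\<phi>\<in>R_f. \<exists>\<mu>1\<in>invariant_measures f. \<exists>\<mu>2\<in>invariant_measures f.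
                 (\<integral>x. apply_bcontfun \<phi> x \<partial>\<mu>1) \<noteq> (\<integral>x. apply_bcontfun \<phi> x \<partial>\<mu>2))"
    if "f \<in> R" for f
  proof -
    have f: "f \<in> two_finite_invariant_sets"
      using that interior_of_subset[of Homeo_topology two_finite_invariant_sets] unfolding R_def by blast
    then obtain S T where S: "finite S" "S \<noteq> {}" "f ` S = S" and T: "finite T" "T \<noteq> {}" "f ` T = T"
      and disj: "S \<inter> T = {}" and fH: "f \<in> Homeo"
      unfolding two_finite_invariant_sets_def by blast
    define R_f where "R_f = {\<phi> :: 'a \<Rightarrow>\<^sub>C (real ^ 'd).
      (1 / real (card S)) *\<^sub>R (\<Sum>x\<in>S. apply_bcontfun \<phi> x) \<noteq> (1 / real (card T)) *\<^sub>R (\<Sum>x\<in>T. apply_bcontfun \<phi> x)}"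
    have "open R_f" "closure R_f = UNIV"
      unfolding R_f_def using averages_differ_open_dense[OF S(1,2) T(1,2) disj] by auto
    then have "baire_residual euclidean R_f"
      unfolding baire_residual_def by (intro conjI exI[of _ "\<lambda>_. R_f"]) auto
    moreover have "uniform_measure_on S \<in> invariant_measures f" "uniform_measure_on T \<in> invariant_measures f"
      using S T HomeoD(1)[OF fH] by (auto intro: uniform_measure_on_invariant)
    moreover have "(\<integral>x. apply_bcontfun \<phi> x \<partial>uniform_measure_on S) \<noteq> (\<integral>x. apply_bcontfun \<phi> x \<partial>uniform_measure_on T)"
      if "\<phi> \<in> R_f" for \<phi>
      using that S T by (simp add: R_f_def integral_uniform_measure_on)
    ultimately show ?thesis by blast
  qed
  ultimately show ?thesis by blast
qed

end
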